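(* The only Fibonacci numbers that are squares of Lucas numbers (with positive indices) are $F_1 = L_1^2 = 1$ and $F_2 = L_1^2 = 1$; that is, for positive integers $k, n$, the equation $F_k = L_n^2$ holds if and only if $(k,n) \in \{(1,1),\ (2,1)\}$.
   Context: $(F_n)_{n\geqslant 0}$ is the Fibonacci sequence: $F_0=0$, $F_1=1$, $F_{n+1}=F_n+F_{n-1}$ for $n \geqslant 1$. $(L_n)_{n\geqslant 0}$ is the Lucas sequence: $L_0=2$, $L_1=1$, $L_{n+1}=L_n+L_{n-1}$ for $n\geqslant 1$. *)

theory Defs
  imports "HOL-Number_Theory.Number_Theory"
begin

fun lucas :: "nat \<Rightarrow> nat" where
  "lucas 0 = 2"
| "lucas (Suc 0) = 1"
| "lucas (Suc (Suc n)) = lucas (Suc n) + lucas n"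

end

(* For n \<ge> 3 the square of the n-th Lucas number lies strictly between the consecutive Fibonacci
   numbers with indices 2n+1 and 2n+2. With a = fib (n+1) and b = fib n, the three quantities are
   (2a - b)^2, a^2 + b^2 and a^2 + 2ab, so this only needs 4/3 < a/b < 1 + sqrt (2/3). *)
theory Submission
  imports Defs
begin

lemma lucas_add_fib: "lucas n + fib n = 2 * fib (Suc n)"
  by (induction n rule: lucas.induct) auto

lemma fib_Suc_double: "fib (Suc (2 * n)) = (fib (Suc n))\<^sup>2 + (fib n)\<^sup>2"
  using fib_add[of n n] by (simp add: mult_2 power2_eq_square)

lemma fib_Suc_Suc_double:
  "fib (Suc (Suc (2 * n))) = (fib (Suc n))\<^sup>2 + 2 * fib (Suc n) * fib n"
  using fib_add[of n "Suc n"] by (simp add: mult_2 power2_eq_square distrib_right)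

text \<open>The ratio r of consecutive Fibonacci numbers evolves by r -> 1 + 1/r, which maps
  [3/2, 5/3] into itself. The endpoints are the ratios at n = 3 and n = 4.\<close>

lemma fib_ratio_bounds:
  assumes "n \<ge> 3"
  shows "3 * fib n \<le> 2 * fib (Suc n) \<and> 3 * fib (Suc n) \<le> 5 * fib n"
  using assms by (induction n rule: dec_induct) (auto simp: numeral_eq_Suc)

lemma lucas_square_between_fib:
  assumes "n \<ge> 3"
  shows "fib (Suc (2 * n)) < (lucas n)\<^sup>2" and "(lucas n)\<^sup>2 < fib (Suc (Suc (2 * n)))"
proof -
  \<comment> \<open>Passing to integers keeps the difference \<open>2 * a - b\<close> from being
    truncated.\<close>
  define a b where "a = int (fib (Suc n))" and "b = int (fib n)"
  have b: "b > 0"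
    using assms by (simp add: b_def fib_neq_0_nat)
  have lo: "3 * b \<le> 2 * a" and hi: "3 * a \<le> 5 * b"
    using fib_ratio_bounds[OF assms] by (simp_all add: a_def b_def)
  have lucas: "int (lucas n) = 2 * a - b"
    using lucas_add_fib[of n] by (simp add: a_def b_def)
  \<comment> \<open>This product is exactly (2a - b)^2 - (a^2 + b^2).\<close>
  have "0 < a * (3 * a - 4 * b)"
    using b lo by (intro mult_pos_pos) auto
  hence "a\<^sup>2 + b\<^sup>2 < (2 * a - b)\<^sup>2"
    by (simp add: power2_eq_square algebra_simps)
  hence "int (fib (Suc (2 * n))) < int ((lucas n)\<^sup>2)"
    by (simp add: fib_Suc_double lucas a_def b_def)
  thus "fib (Suc (2 * n)) < (lucas n)\<^sup>2"
    by linarith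
  \<comment> \<open>The two products add up to a^2 + 2ab - (2a - b)^2.\<close>
  have "0 \<le> a * (5 * b - 3 * a)" and "0 < b * (a - b)"
    using b lo hi by auto
  hence "(2 * a - b)\<^sup>2 < a\<^sup>2 + 2 * a * b"
    by (simp add: power2_eq_square algebra_simps)
  hence "int ((lucas n)\<^sup>2) < int (fib (Suc (Suc (2 * n))))"
    by (simp add: fib_Suc_Suc_double lucas a_def b_def del: fib.simps)
  thus "(lucas n)\<^sup>2 < fib (Suc (Suc (2 * n)))"
    by linarith
qed

lemma fib_neq_between:
  assumes "fib m < x" and "x < fib (Suc m)"
  shows "fib k \<noteq> x"
  using assms fib_mono[of k m] fib_mono[of "Suc m" k] by (cases "k \<le> m") auto

theorem corollary2:
  fixes k n :: nat
  assumes "k > 0" and "n > 0"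
  shows "fib k = (lucas n)\<^sup>2 \<longleftrightarrow> (k, n) \<in> {(1, 1), (2, 1)}"
proof -
  consider "n = 1" | "n = 2" | "n \<ge> 3"
    using assms by linarith
  thus ?thesis
  proof cases
    case 1
    have "fib k \<noteq> 1" if "k \<ge> 3"
      using fib_mono[OF that] by (simp add: numeral_eq_Suc)
    moreover have "k = 1 \<or> k = 2 \<or> k \<ge> 3"
      using assms by linarith
    ultimately show ?thesis
      using 1 by (auto simp: numeral_eq_Suc)
  next
    case 2
    \<comment> \<open>The general upper bound fails at n = 2, where 9 exceeds F_6 = 8; the square
      falls one gap later, below F_7 = 13.\<close>
    have "fib k \<noteq> 9"
      by (rule fib_neq_between[of 6]) (simp_all add: numeral_eq_Suc)
    thus ?thesis
      using 2 by (simp add: numeral_2_eq_2)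
  next
    case 3
    thus ?thesis
      using fib_neq_between[OF lucas_square_between_fib[OF 3]] by auto
  qed
qed

end
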